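(* Let $N$ be a GA1 number with $\Omega(N)\ge 3$, and let $p=P(N)$ be its largest prime factor. Then $v_p(N)=1$.
   Context: For an integer $n>1$ let $G(n)=\dfrac{\sigma(n)}{n\log\log n}$, where $\sigma(n)=\sum_{d\mid n}d$. A GA1 number is a composite integer $N$ such that $G(N)\ge G(N/p)$ for every prime $p$ dividing $N$. $v_p(n)$ is the exponent of the prime $p$ in $n$, $\Omega(n)=\sum_p v_p(n)$, and $P(n)$ is the largest prime factor of $n>1$. *)

theory Defs
  imports Complex_Main "HOL-Computational_Algebra.Primes"
begin

definition sigma :: "nat \<Rightarrow> nat" where
  "sigma n = (\<Sum>d | d dvd n. d)"

text \<open>
  The function \<open>G\<close> is meant for \<open>n > 1\<close> only. It is negative at \<open>n = 2\<close>, as \<open>ln (ln 2) < 0\<close>.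
\<close>
definition gronwall_G :: "nat \<Rightarrow> real" where
  "gronwall_G n = real (sigma n) / (real n * ln (ln (real n)))"

text \<open>
  Since \<open>N\<close> is composite, every \<open>N div p\<close> below is an exact quotient greater than 1.
\<close>
definition GA1 :: "nat \<Rightarrow> bool" where
  "GA1 N \<longleftrightarrow> N > 1 \<and> \<not> prime N \<and>
     (\<forall>p. prime p \<and> p dvd N \<longrightarrow> gronwall_G N \<ge> gronwall_G (N div p))"

definition big_Omega :: "nat \<Rightarrow> nat" where
  "big_Omega n = (\<Sum>p\<in>prime_factors n. multiplicity p n)"

definition largest_prime_factor :: "nat \<Rightarrow> nat" where
  "largest_prime_factor n = Max (prime_factors n)"

end

(*
  Write L = ln N and X = L ln L. For a prime q exactly dividing N to the power v, the condition
  G(N) >= G(N/q) and the concavity of ln give (q + ... + q^v) ln q <= X, so that q^v <= X.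
  Summing ln (q^v) over the at most (p + 1)/2 prime factors of N bounds L by K ln X with K the number
  of prime factors. If v_p(N) >= 2 then 3 K^2 <= (p + p^2) ln p <= X, and the two bounds together say
  that L is less than a small multiple of (ln L)^3, which contradicts exp y >= (e y / 3)^3.
*)
theory Submission
  imports Defs "HOL-Analysis.Harmonic_Numbers"
begin

section \<open>Divisor sums along the powers of one prime\<close>

lemma sigma_prime_mult:
  fixes q k m :: nat
  assumes q: "prime q" and m: "\<not> q dvd m"
  shows "sigma (q ^ Suc k * m) = q * sigma (q ^ k * m) + sigma m"
proof -
  let ?A = "(*) q ` {d. d dvd q ^ k * m}" and ?B = "{d. d dvd m}"
  have pos: "q > 0" "m > 0" using q m by (auto simp: prime_gt_0_nat intro: Nat.gr0I)
  \<comment> \<open>A divisor of \<open>q ^ Suc k * m\<close> is either a multiple of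
    \<open>q\<close>, hence \<open>q\<close> times a divisor of \<open>q ^ k * m\<close>, or coprime
    to \<open>q\<close>, hence a divisor of \<open>m\<close>.\<close>
  have "{d. d dvd q ^ Suc k * m} = ?A \<union> ?B"
  proof (intro equalityI subsetI)
    fix d assume "d \<in> {d. d dvd q ^ Suc k * m}"
    hence d: "d dvd q ^ Suc k * m" by simp
    show "d \<in> ?A \<union> ?B"
    proof (cases "q dvd d")
      case True
      then obtain c where "d = q * c" by (elim dvdE)
      with d pos show ?thesis by (auto simp: mult.assoc)
    next
      case False
      hence "coprime d (q ^ Suc k)"
        using q by (metis coprime_commute coprime_power_right_iff prime_imp_coprime)
      with d show ?thesis by (metis coprime_dvd_mult_right_iff UnI2 mem_Collect_eq)
    qed
  next
    fix d assume "d \<in> ?A \<union> ?B"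
    thus "d \<in> {d. d dvd q ^ Suc k * m}" by (auto simp: mult.assoc)
  qed
  moreover have "?A \<inter> ?B = {}" using m by (auto dest: dvd_mult_left)
  moreover have "finite {d. d dvd q ^ k * m}" "finite ?B" using pos by auto
  ultimately have "sigma (q ^ Suc k * m) = \<Sum> ?A + \<Sum> ?B"
    unfolding sigma_def by (simp add: sum.union_disjoint)
  also have "\<Sum> ?A = q * sigma (q ^ k * m)"
    unfolding sigma_def using pos by (subst sum.reindex) (auto simp: inj_on_def sum_distrib_left)
  finally show ?thesis by (simp add: sigma_def)
qed

lemma sigma_prime_power_mult:
  fixes q k m :: nat
  assumes "prime q" and "\<not> q dvd m"
  shows "sigma (q ^ k * m) = (\<Sum>i\<le>k. q ^ i) * sigma m"
proof (induction k)
  case (Suc k)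
  have "(\<Sum>i\<le>Suc k. q ^ i) = 1 + q * (\<Sum>i\<le>k. q ^ i)"
    by (subst sum.atMost_Suc_shift) (simp add: sum_distrib_left)
  with Suc show ?case using sigma_prime_mult[OF assms, of k] by (simp add: algebra_simps)
qed simp

lemma sigma_pos: "n > 0 \<Longrightarrow> sigma n > 0"
  unfolding sigma_def by (rule sum_pos2[of _ n]) auto

section \<open>The bound that the GA1 condition puts on each prime power in N\<close>

lemma big_Omega_conv_size: "big_Omega n = size (prime_factorization n)"
  unfolding big_Omega_def size_multiset_overloaded_eq
  by (intro sum.cong) (auto simp: count_prime_factorization)

lemma two_power_big_Omega_le:
  assumes "n > 0"
  shows "2 ^ big_Omega n \<le> n"
proof -
  have "2 ^ big_Omega n = (\<Prod>p\<in>prime_factors n. 2 ^ multiplicity p n)"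
    unfolding big_Omega_def by (rule power_sum)
  also have "\<dots> \<le> (\<Prod>p\<in>prime_factors n. p ^ multiplicity p n)"
    by (intro prod_mono conjI power_mono)
       (auto simp: in_prime_factors_iff prime_ge_2_nat)
  also have "\<dots> = n" using assms by (simp add: prod_prime_factors)
  finally show ?thesis .
qed

text \<open>This is ln t \<le> t - 1 at t = \<open>ln x / ln (q * x)\<close>. It removes the
  iterated logarithms from the comparison of G(N) with G(N/q).\<close>

lemma ln_ln_diff_ge:
  fixes x q :: real
  assumes "q > 0" and "1 < x" and "1 < q * x"
  shows "ln q / ln (q * x) \<le> ln (ln (q * x)) - ln (ln x)"
proof -
  have pos: "ln x > 0" "ln (q * x) > 0" using assms by auto
  have "ln (ln x / ln (q * x)) \<le> ln x / ln (q * x) - 1"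
    using pos by (intro ln_le_minus_one) auto
  also have "\<dots> = (ln x - ln (q * x)) / ln (q * x)" using pos by (simp add: diff_divide_distrib)
  also have "\<dots> = - (ln q / ln (q * x))" using assms by (simp add: ln_mult)
  finally show ?thesis using pos by (simp add: ln_div)
qed

lemma ln_ge_1: "x \<ge> 3 \<Longrightarrow> ln (x::real) \<ge> 1"
  using exp_le ln_ge_iff[of x 1] by linarith

text \<open>With \<open>N = q * M\<close>, both divisor sums contain the factor
  \<open>s = sigma m\<close>. After cancelling it, G(M) \<le> G(N) reads
  \<open>real q * T * (A - B) \<le> B\<close>, where \<open>A - B\<close> is at least ln q / ln N
  and \<open>B < A\<close>.\<close>

lemma GA1_prime_power_bound:
  assumes GA1: "GA1 N" and Omega: "big_Omega N \<ge> 3" and q: "prime q" "q dvd N"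
  shows "(\<Sum>i=1..multiplicity q N. real q ^ i) * ln (real q) \<le> ln (real N) * ln (ln (real N))"
    and "ln (ln (real N)) > 0"
proof -
  have N: "N > 1" using GA1 by (simp add: GA1_def)
  have "N \<noteq> 0" "\<not> is_unit q" using N q(1) not_prime_unit by auto
  then obtain m where m: "N = q ^ multiplicity q N * m" "\<not> q dvd m"
    by (rule multiplicity_decompose')
  have "multiplicity q N > 0" using q N by (simp add: prime_multiplicity_gt_zero_iff)
  then obtain k where k: "multiplicity q N = Suc k" by (auto simp: gr0_conv_Suc)
  define M where "M = q ^ k * m"
  have NM: "N = q * M" using m(1) k by (simp add: M_def)
  have M: "M > 0" and q2: "q \<ge> 2" using NM N q by (auto intro: Nat.gr0I prime_ge_2_nat)
  have m0: "m > 0" using m(2) by (auto intro: Nat.gr0I)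
  have "big_Omega N = Suc (big_Omega M)"
    using q M by (simp add: NM big_Omega_conv_size prime_factorization_mult prime_factorization_prime)
  \<comment> \<open>At least two prime factors remain in \<open>M\<close>, so \<open>M\<close>
    exceeds e and ln ln M is positive; the denominators of G can then be cleared without reversing
    the inequality.\<close>
  hence "2 ^ 2 \<le> (2::nat) ^ big_Omega M" using Omega by (intro power_increasing) auto
  with two_power_big_Omega_le[OF M] have M4: "M \<ge> 4" by simp
  have MN: "M < N" using M q2 by (simp add: NM)
  have lnM: "ln (real M) > 1"
  proof -
    have "1 \<le> ln (3::real)" by (rule ln_ge_1) simp
    also have "\<dots> < ln (real M)" using M4 by simp
    finally show ?thesis .
  qed
  define A B where "A = ln (ln (real N))" and "B = ln (ln (real M))"
  have "ln (real M) < ln (real N)" using M MN by simp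
  hence L: "ln (real N) > 1" and AB: "B < A" and B: "B > 0"
    using lnM by (auto simp: A_def B_def)
  show "ln (ln (real N)) > 0" using AB B by (simp add: A_def)
  define T where "T = real (\<Sum>i\<le>k. q ^ i)"
  define s where "s = real (sigma m)"
  have s: "s > 0" using sigma_pos[OF m0] by (simp add: s_def)
  have T: "T > 0"
  proof -
    have "(\<Sum>i\<le>k. q ^ i) > 0" using q2 by (intro sum_pos) auto
    thus ?thesis unfolding T_def by linarith
  qed
  \<comment> \<open>\<open>T\<close> runs over the exponents 0 to \<open>k\<close> and the
    multiplicity is \<open>Suc k\<close>, so the factor \<open>q\<close> shifts the range to 1 up to
    the multiplicity.\<close>
  have S: "(\<Sum>i=1..multiplicity q N. real q ^ i) = real q * T"
    unfolding T_def k One_nat_def sum.shift_bounds_cl_Suc_ivl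
    by (simp add: sum_distrib_left atLeast0AtMost)
  have sigM: "real (sigma M) = T * s"
    unfolding M_def T_def s_def sigma_prime_power_mult[OF q(1) m(2)] by simp
  have sigN: "real (sigma N) = (real q * T + 1) * s"
    using sigma_prime_mult[OF q(1) m(2), of k] m(1) k sigM
    by (simp add: M_def s_def algebra_simps)
  have "gronwall_G (N div q) \<le> gronwall_G N"
    using GA1 q unfolding GA1_def by blast
  moreover have "N div q = M" using NM q2 by simp
  ultimately have "gronwall_G M \<le> gronwall_G N" by simp
  hence "T * s / (M * B) \<le> (real q * T + 1) * s / (real q * M * A)"
    unfolding gronwall_G_def sigM sigN A_def B_def by (simp add: NM)
  hence "s * (T * real q * A) \<le> s * ((real q * T + 1) * B)"
    using M q2 AB B by (simp add: field_simps)
  hence "T * real q * A \<le> (real q * T + 1) * B" using s by simp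
  hence "real q * T * (A - B) \<le> B" by (simp add: algebra_simps)
  moreover have "ln q / ln N \<le> A - B"
    using ln_ln_diff_ge[of q M] q2 M4 N by (simp add: A_def B_def NM flip: of_nat_mult)
  hence "real q * T * (ln q / ln N) \<le> real q * T * (A - B)"
    using T by (intro mult_left_mono) auto
  ultimately have "real q * T * (ln q / ln N) \<le> A" using AB by linarith
  thus "(\<Sum>i=1..multiplicity q N. real q ^ i) * ln (real q) \<le> ln (real N) * ln (ln (real N))"
    unfolding S using L by (simp add: A_def field_simps)
qed

section \<open>Counting primes, and numerical bounds for exp and ln\<close>

lemma card_prime_factors_le:
  assumes "\<And>q. q \<in> prime_factors N \<Longrightarrow> q \<le> (p::nat)" and "p \<ge> 1"
  shows "2 * card (prime_factors N) \<le> p + 1"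
proof -
  \<comment> \<open>Apart from 2, every prime up to \<open>p\<close> is an odd number 2k + 1 with 1
    \<le> k \<le> (p - 1)/2.\<close>
  let ?C = "(\<lambda>k. 2 * k + 1) ` {1..(p - 1) div 2}"
  have "prime_factors N \<subseteq> insert 2 ?C"
  proof
    fix q assume q: "q \<in> prime_factors N"
    hence pr: "prime q" by (simp add: in_prime_factors_iff)
    show "q \<in> insert 2 ?C"
    proof (cases "q = 2")
      case False
      with pr have "odd q" "q > 2"
        using prime_odd_nat prime_ge_2_nat[of q] by (auto simp: le_less)
      then obtain k where "q = 2 * k + 1" by (elim oddE)
      with \<open>q > 2\<close> assms(1)[OF q] show ?thesis by (auto intro!: imageI)
    qed simp
  qed
  hence "card (prime_factors N) \<le> card (insert 2 ?C)" by (intro card_mono) auto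
  also have "\<dots> \<le> Suc (card ?C)" by (rule card_insert_le_m1) auto
  also have "\<dots> \<le> Suc ((p - 1) div 2)" using card_image_le[of "{1..(p - 1) div 2}"] by auto
  finally show ?thesis using assms(2) by linarith
qed

text \<open>The quadratic Taylor polynomial at 1/4 is 1 + 1/4 + 1/32 = 41/32, whose fourth power is
  about 2.6949.\<close>

lemma exp_1_ge: "exp (1::real) \<ge> 269 / 100"
proof -
  have "(41 / 32) ^ 4 \<le> exp (1 / 4 :: real) ^ 4"
    using exp_lower_Taylor_quadratic[of "1 / 4 :: real"]
    by (intro power_mono) (auto simp: power2_eq_square)
  also have "\<dots> = exp 1" by (simp flip: exp_of_nat_mult)
  finally show ?thesis by (simp add: power_numeral_reduce)
qed

text \<open>The left side is the tangent to exp at 1.\<close>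

lemma exp_1_mult_le_exp: "exp 1 * y \<le> exp (y::real)"
proof -
  have "y \<le> exp (y - 1)" using exp_ge_add_one_self[of "y - 1"] by simp
  thus ?thesis by (simp add: exp_diff field_simps)
qed

text \<open>The tangent bound at \<open>y / 3\<close>, cubed; (2.69/3)^3 is about 0.72.\<close>

lemma exp_ge_cube:
  fixes y :: real
  assumes "y \<ge> 0"
  shows "7 / 10 * y ^ 3 \<le> exp y"
proof -
  have "269 / 100 * (y / 3) \<le> exp 1 * (y / 3)"
    using exp_1_ge assms by (intro mult_right_mono) auto
  also have "\<dots> \<le> exp (y / 3)" by (rule exp_1_mult_le_exp)
  finally have "(269 / 300 * y) ^ 3 \<le> exp (y / 3) ^ 3"
    using assms by (intro power_mono) auto
  also have "\<dots> = exp y" by (simp flip: exp_of_nat_mult)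
  finally have "(269 / 300) ^ 3 * y ^ 3 \<le> exp y" by (simp only: power_mult_distrib)
  moreover have "7 / 10 * y ^ 3 \<le> (269 / 300) ^ 3 * y ^ 3"
    using assms by (intro mult_right_mono) (auto simp: power_numeral_reduce)
  ultimately show ?thesis by linarith
qed

text \<open>The tangent bound at \<open>ln y\<close>, with e weakened to 5/2.\<close>

lemma ln_le_two_fifths:
  fixes y :: real
  assumes "y > 0"
  shows "ln y \<le> 2 / 5 * y"
proof -
  have "exp 1 * ln y \<le> y" using exp_1_mult_le_exp[of "ln y"] assms by simp
  hence "ln y \<le> y / exp 1" by (simp add: field_simps)
  also have "\<dots> \<le> y / (5 / 2)" using exp_1_ge assms by (intro divide_left_mono) auto
  finally show ?thesis by simp
qed

section \<open>The contradiction from a repeated largest prime factor\<close>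

theorem theorem12:
  fixes N p :: nat
  assumes "GA1 N"
    and "big_Omega N \<ge> 3"
    and "p = largest_prime_factor N"
  shows "multiplicity p N = 1"
proof (rule ccontr)
  assume mult: "multiplicity p N \<noteq> 1"
  have N: "N > 1" using assms(1) by (simp add: GA1_def)
  have "prime_factors N \<noteq> {}" using assms(2) by (auto simp: big_Omega_def)
  hence p: "p \<in> prime_factors N" and max: "\<And>q. q \<in> prime_factors N \<Longrightarrow> q \<le> p"
    using assms(3) by (auto simp: largest_prime_factor_def intro: Max_in)
  have pp: "prime p" "p dvd N" using p by (auto simp: in_prime_factors_iff)
  have p2: "p \<ge> 2" using pp(1) by (rule prime_ge_2_nat)
  have "multiplicity p N > 0" using pp N by (simp add: prime_multiplicity_gt_zero_iff)
  with mult have v2: "multiplicity p N \<ge> 2" by linarith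
  define L where "L = ln (real N)"
  define y where "y = ln L"
  define K where "K = real (card (prime_factors N))"
  note bound = GA1_prime_power_bound[OF assms(1,2), folded L_def, folded y_def]
  have y: "y > 0" using bound(2)[OF pp] .
  have "L > 0" using N by (simp add: L_def)
  hence expy: "exp y = L" by (simp add: y_def)
  \<comment> \<open>Only the first two terms of the sum for \<open>p\<close> are kept; both occur
    because the exponent is at least 2.\<close>
  have "(real p + real p ^ 2) * ln p = (\<Sum>i=1..2. real p ^ i) * ln p"
    by (simp add: numeral_2_eq_2)
  also have "\<dots> \<le> (\<Sum>i=1..multiplicity p N. real p ^ i) * ln p"
    using v2 p2 by (intro mult_right_mono sum_mono2) auto
  also have "\<dots> \<le> L * y" using bound(1)[OF pp] .
  finally have Xp: "(real p + real p ^ 2) * ln p \<le> L * y" .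

  have K: "2 * K \<le> real p + 1"
    using card_prime_factors_le[of N p] max p2 unfolding K_def by force
  \<comment> \<open>The bound 4 serves the powers of 2 below. The case \<open>p = 2\<close> is
    separate because ln 2 < 1; there \<open>K \<le> 1\<close>, and 6 ln 2 \<ge> 4 gives both
    claims.\<close>
  have K3X4: "3 * K ^ 2 \<le> (real p + real p ^ 2) * ln p \<and> 4 \<le> (real p + real p ^ 2) * ln p"
  proof (cases "p = 2")
    case True
    hence "2 * card (prime_factors N) \<le> 3" using card_prime_factors_le[of N p] max by auto
    hence "K \<le> 1" unfolding K_def by simp
    hence "K ^ 2 \<le> 1" by (intro power_le_one) (auto simp: K_def)
    with True ln2_ge_two_thirds show ?thesis by simp
  next
    case False
    hence p3: "real p \<ge> 3" using p2 by linarith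
    have "4 * K ^ 2 \<le> (real p + 1) ^ 2"
      using K power_mono[of "2 * K" "real p + 1" 2] by (simp add: K_def power_mult_distrib)
    \<comment> \<open>The difference of the two sides is (p - 3)(p + 1).\<close>
    moreover have "3 * (real p + 1) ^ 2 \<le> 4 * (real p + real p ^ 2)"
      using mult_nonneg_nonneg[of "real p - 3" "real p + 1"] p3
      by (simp add: power2_eq_square algebra_simps)
    ultimately have "3 * K ^ 2 \<le> real p + real p ^ 2" by simp
    moreover have "4 \<le> real p + real p ^ 2" using p3 zero_le_power2[of "real p - 1"]
      by (simp add: power2_eq_square algebra_simps)
    moreover have "real p + real p ^ 2 \<le> (real p + real p ^ 2) * ln p"
      using mult_left_mono[OF ln_ge_1[OF p3], of "real p + real p ^ 2"] by simp
    ultimately show ?thesis by (meson order.trans)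
  qed
  hence K3: "3 * K ^ 2 \<le> L * y" and X4: "4 \<le> L * y" using Xp by linarith+

  have summand: "real (multiplicity q N) * ln q \<le> ln (L * y)" if "q \<in> prime_factors N" for q
  proof -
    define v where "v = multiplicity q N"
    have q: "prime q" "q dvd N" using that by (auto simp: in_prime_factors_iff)
    have q2: "q \<ge> 2" using q(1) by (rule prime_ge_2_nat)
    have v1: "v \<ge> 1" using q N by (simp add: v_def Suc_le_eq prime_multiplicity_gt_zero_iff)
    note b = bound(1)[OF q, folded v_def]
    \<comment> \<open>For \<open>q \<ge> 3\<close> the top term of the sum suffices, as ln q \<ge>
      1. For \<open>q = 2\<close> the whole sum and ln 2 \<ge> 2/3 give 2^v \<le> 1 + (3/4) X, which
      is at most X because X \<ge> 4.\<close>
    have "real q ^ v \<le> L * y"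
    proof (cases "q = 2")
      case True
      have "(\<Sum>i=1..v. (2::real) ^ i) = 2 * 2 ^ v - 2"
        by (induction v) auto
      with b True have "(2 * 2 ^ v - 2) * ln 2 \<le> L * y" by simp
      moreover have "(2 * 2 ^ v - 2) * (2 / 3) \<le> (2 * 2 ^ v - 2) * ln (2::real)"
        using ln2_ge_two_thirds by (intro mult_left_mono) auto
      ultimately show ?thesis using X4 True by simp
    next
      case False
      hence "real q \<ge> 3" using q2 by linarith
      hence "1 \<le> ln (real q)" by (rule ln_ge_1)
      hence "real q ^ v * 1 \<le> (\<Sum>i=1..v. real q ^ i) * ln q"
        using v1 by (intro mult_mono member_le_sum sum_nonneg) auto
      with b show ?thesis by simp
    qed
    hence "ln (real q ^ v) \<le> ln (L * y)" using q2 by (intro ln_mono) auto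
    thus ?thesis using q2 by (simp add: ln_realpow v_def)
  qed

  have "real N = (\<Prod>q\<in>prime_factors N. real q ^ multiplicity q N)"
    using N prod_prime_factors[of N] by (simp flip: of_nat_power of_nat_prod)
  hence "L = (\<Sum>q\<in>prime_factors N. ln (real q ^ multiplicity q N))"
    unfolding L_def by (subst ln_prod[symmetric]) (auto simp: in_prime_factors_iff prime_gt_0_nat)
  also have "\<dots> = (\<Sum>q\<in>prime_factors N. real (multiplicity q N) * ln q)"
    by (simp add: ln_realpow)
  also have "\<dots> \<le> K * ln (L * y)"
    unfolding K_def by (intro sum_bounded_above summand)
  also have "ln (L * y) = y + ln y" using \<open>L > 0\<close> y by (simp add: ln_mult y_def)
  \<comment> \<open>7/5 is 1 + 2/5, the 2/5 coming from the bound on \<open>ln y\<close>.\<close>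
  also have "K * (y + ln y) \<le> K * (7 / 5 * y)"
    using ln_le_two_fifths[OF y] by (intro mult_left_mono) (auto simp: K_def)
  \<comment> \<open>Squaring brings in K^2, which \<open>K3\<close> bounds by a third of
    \<open>L * y\<close>; one factor \<open>L\<close> then cancels.\<close>
  finally have "L ^ 2 \<le> (K * (7 / 5 * y)) ^ 2" using \<open>L > 0\<close> by (intro power_mono) auto
  hence "3 * L ^ 2 \<le> 3 * K ^ 2 * (49 / 25 * y ^ 2)"
    by (simp add: power_mult_distrib power_divide)
  also have "\<dots> \<le> L * y * (49 / 25 * y ^ 2)" using K3 by (intro mult_right_mono) auto
  finally have "L * (3 * L) \<le> L * (49 / 25 * y ^ 3)"
    by (simp add: power2_eq_square power3_eq_cube mult_ac)
  \<comment> \<open>The cubic lower bound for \<open>exp y = L\<close> gives 3L \<ge> 2.1 y^3,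
    against the 1.96 y^3 here.\<close>
  hence "3 * L \<le> 49 / 25 * y ^ 3" using \<open>L > 0\<close> by simp
  moreover have "7 / 10 * y ^ 3 \<le> L" using exp_ge_cube[of y] y expy by simp
  moreover have "y ^ 3 > 0" using y by simp
  ultimately show False by linarith
qed

end
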